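(* Let $H$ be a separable Hilbert space and let $K\subset H$ be a compact subset. Then for an arbitrary $C>1$ there exists a frame $\mathcal F=\{h_i\}_{i\in\mathbb N}$ in $H$ with frame constants $A,B$ satisfying $B/A<C$ such that the following is true: for all $f\in K$ and for all $\varepsilon>0$ there exist $h_i\in\mathcal F$ and $c\in\mathbb R$ such that $$\|f-c\,h_i\|_H<\varepsilon.$$
   Context: A sequence $\mathcal F=\{h_k\}_{k\in\mathbb N}$ in a separable Hilbert space $H$ is a frame for $H$ with frame constants $A,B>0$ if $$A^2\sum_{k=1}^\infty|(f,h_k)_H|^2\le\|f\|_H^2\le B^2\sum_{k=1}^\infty|(f,h_k)_H|^2\quad\text{for all } f\in H.$$ *)

theory Defs
  imports "HOL-Analysis.Analysis"
begin

text \<open>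
  The constants enter squared, and they bound the norm of \<open>f\<close> by the frame sum rather than the
  other way round. Since \<^const>\<open>suminf\<close> is unspecified on divergent series, the finiteness
  of the sum, implied by the first inequality for \<open>A > 0\<close>, has to be stated.
\<close>

definition frame_with_constants :: "(nat \<Rightarrow> 'a::real_inner) \<Rightarrow> real \<Rightarrow> real \<Rightarrow> bool"
  where "frame_with_constants h A B \<longleftrightarrow>
    A > 0 \<and> B > 0 \<and>
    (\<forall>f. summable (\<lambda>k. \<bar>f \<bullet> h k\<bar>\<^sup>2) \<and>
         A\<^sup>2 * (\<Sum>k. \<bar>f \<bullet> h k\<bar>\<^sup>2) \<le> (norm f)\<^sup>2 \<and>
         (norm f)\<^sup>2 \<le> B\<^sup>2 * (\<Sum>k. \<bar>f \<bullet> h k\<bar>\<^sup>2))"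

end

theory Submission
  imports Defs
begin

text \<open>
  Adding a few small vectors to an orthonormal basis spoils its frame constants only slightly, and
  the line through a vector does not change when the vector is rescaled. So let \<open>d\<close> be a
  dense sequence in \<open>H\<close>. Gram--Schmidt turns it into an orthonormal sequence \<open>e\<close>
  (with zeros where \<open>d\<close> is linearly dependent) that satisfies Parseval's identity because
  \<open>d\<close> is dense (\<open>parseval_gram_schmidt\<close>). Multiply each \<open>d n\<close> by a factor
  \<open>t n > 0\<close> so small that \<open>\<Sum>n. (norm (t n *\<^sub>R d n))\<^sup>2 \<le> \<delta>\<close>, and interleave
  the two sequences. By Cauchy--Schwarz the frame sum of \<open>f\<close> lies between
  \<open>(norm f)\<^sup>2\<close> and \<open>(1 + \<delta>) * (norm f)\<^sup>2\<close>
  (\<open>frame_interleave_small\<close>), which gives the ratio \<open>sqrt (1 + \<delta>)\<close> of frame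
  constants, and this is below \<open>C\<close> for small \<open>\<delta>\<close>. A given \<open>f\<close>
  is approximated by some \<open>d n\<close>, a multiple of the frame element \<open>t n *\<^sub>R d n\<close>.
\<close>

section \<open>Gram--Schmidt orthogonalisation of a sequence\<close>

text \<open>
  Recursing on the residual map \<open>x \<mapsto> x - (\<Sum>k<n. (x \<bullet> e k) *\<^sub>R e k)\<close>, rather than on
  the orthonormal vectors \<open>e k\<close>, makes the recursion primitive. Since \<open>sgn 0 = 0\<close>,
  a vector that depends linearly on its predecessors contributes the zero vector.
\<close>

primrec gs_residual :: "(nat \<Rightarrow> 'a::real_inner) \<Rightarrow> nat \<Rightarrow> 'a \<Rightarrow> 'a" where
  "gs_residual d 0 x = x"
| "gs_residual d (Suc n) x =
     gs_residual d n x - (x \<bullet> sgn (gs_residual d n (d n))) *\<^sub>R sgn (gs_residual d n (d n))"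

definition gram_schmidt :: "(nat \<Rightarrow> 'a::real_inner) \<Rightarrow> nat \<Rightarrow> 'a" where
  "gram_schmidt d n = sgn (gs_residual d n (d n))"

lemma gs_residual_Suc:
  "gs_residual d (Suc n) x = gs_residual d n x - (x \<bullet> gram_schmidt d n) *\<^sub>R gram_schmidt d n"
  by (simp add: gram_schmidt_def)

lemma gs_residual_diff: "gs_residual d n (x - y) = gs_residual d n x - gs_residual d n y"
  by (induction n) (simp_all add: inner_diff_left algebra_simps)

lemma inner_sgn_self: "x \<bullet> sgn x = norm (x :: 'a::real_inner)"
  by (cases "x = 0") (simp_all add: sgn_div_norm dot_square_norm power2_eq_square)

lemma inner_mult_sgn_sgn: "(y \<bullet> sgn x) * (sgn x \<bullet> sgn x) = y \<bullet> sgn (x :: 'a::real_inner)"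
  by (cases "x = 0") (simp_all add: dot_square_norm norm_sgn)

lemma gs_residual_eq_sum:
  "gs_residual d n x = x - (\<Sum>k<n. (x \<bullet> gram_schmidt d k) *\<^sub>R gram_schmidt d k)"
  by (induction n) (simp_all add: gs_residual_Suc del: gs_residual.simps(2))

lemma inner_gs_residual_gram_schmidt_eq_0:
  assumes "k < n"
  shows "gs_residual d n x \<bullet> gram_schmidt d k = 0"
  using assms
proof (induction n arbitrary: k x)
  case 0
  then show ?case by simp
next
  case (Suc n)
  have orth: "gram_schmidt d j \<bullet> gram_schmidt d n = 0" if "j < n" for j
    using Suc.IH[OF that, of "d n"]
    by (subst inner_commute, subst (1) gram_schmidt_def) (simp add: sgn_div_norm)
  show ?case
  proof (cases "k < n")
    case True
    then show ?thesis
      unfolding gs_residual_Suc inner_diff_left inner_scaleR_left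
      using Suc.IH[OF True, of x] orth[OF True] by (simp add: inner_commute)
  next
    case False
    with Suc.prems have "k = n" by simp
    have "gs_residual d n x \<bullet> gram_schmidt d n = x \<bullet> gram_schmidt d n"
      by (simp add: gs_residual_eq_sum inner_diff_left inner_sum_left orth)
    then show ?thesis
      unfolding \<open>k = n\<close> gs_residual_Suc inner_diff_left inner_scaleR_left
      by (simp add: gram_schmidt_def inner_mult_sgn_sgn)
  qed
qed

lemma gram_schmidt_orthogonal:
  assumes "k < n"
  shows "gram_schmidt d k \<bullet> gram_schmidt d n = 0"
  using inner_gs_residual_gram_schmidt_eq_0[OF assms, of d "d n"]
  by (subst inner_commute, subst (1) gram_schmidt_def) (simp add: sgn_div_norm)

lemma inner_gs_residual_gram_schmidt:
  "gs_residual d n x \<bullet> gram_schmidt d n = x \<bullet> gram_schmidt d n"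
  by (simp add: gs_residual_eq_sum inner_diff_left inner_sum_left gram_schmidt_orthogonal)

lemma norm_gs_residual_Suc:
  "(norm (gs_residual d (Suc n) x))\<^sup>2 = (norm (gs_residual d n x))\<^sup>2 - (x \<bullet> gram_schmidt d n)\<^sup>2"
proof -
  define r e where "r = gs_residual d n x" and "e = gram_schmidt d n"
  have re: "r \<bullet> e = x \<bullet> e"
    by (simp add: r_def e_def inner_gs_residual_gram_schmidt)
  have ee: "(x \<bullet> e) * (e \<bullet> e) = x \<bullet> e"
    unfolding e_def gram_schmidt_def by (rule inner_mult_sgn_sgn)
  have "(norm (r - (x \<bullet> e) *\<^sub>R e))\<^sup>2
      = r \<bullet> r - 2 * (x \<bullet> e) * (r \<bullet> e) + (x \<bullet> e) * ((x \<bullet> e) * (e \<bullet> e))"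
    by (simp add: power2_norm_eq_inner inner_diff_left inner_diff_right inner_commute algebra_simps)
  also have "\<dots> = (norm r)\<^sup>2 - (x \<bullet> e)\<^sup>2"
    unfolding re ee power2_norm_eq_inner by (simp add: power2_eq_square)
  finally show ?thesis
    unfolding gs_residual_Suc r_def e_def .
qed

lemma bessel_gram_schmidt:
  "(\<Sum>k<n. (x \<bullet> gram_schmidt d k)\<^sup>2) = (norm x)\<^sup>2 - (norm (gs_residual d n x))\<^sup>2"
  by (induction n) (simp_all add: norm_gs_residual_Suc del: gs_residual.simps(2))

lemma norm_gs_residual_antimono:
  assumes "m \<le> n"
  shows "norm (gs_residual d n x) \<le> norm (gs_residual d m x)"
proof (rule lift_Suc_antimono_le[OF _ assms])
  show "norm (gs_residual d (Suc k) x) \<le> norm (gs_residual d k x)" for k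
    by (rule power2_le_imp_le) (simp_all add: norm_gs_residual_Suc del: gs_residual.simps(2))
qed

lemma gs_residual_Suc_self: "gs_residual d (Suc n) (d n) = 0"
proof -
  have "d n \<bullet> gram_schmidt d n = norm (gs_residual d n (d n))"
    unfolding inner_gs_residual_gram_schmidt[of d n "d n", symmetric]
    by (simp add: gram_schmidt_def inner_sgn_self)
  then show ?thesis
    unfolding gs_residual_Suc
    by (cases "gs_residual d n (d n) = 0") (simp_all add: gram_schmidt_def sgn_div_norm)
qed

text \<open>
  Once the \<open>m\<close>-th vector has been processed, its residual vanishes, so the residual of
  \<open>x\<close> is that of \<open>x - d m\<close> and is at most the distance of \<open>x\<close> to
  \<open>d m\<close>. Density makes it tend to \<open>0\<close>, and Bessel's defect with it.
\<close>

lemma parseval_gram_schmidt: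
  fixes d :: "nat \<Rightarrow> 'a::real_inner"
  assumes dense: "\<And>x \<epsilon>. \<epsilon> > 0 \<Longrightarrow> \<exists>n. norm (x - d n) < \<epsilon>"
  shows "(\<lambda>k. (x \<bullet> gram_schmidt d k)\<^sup>2) sums (norm x)\<^sup>2"
proof -
  have "(\<lambda>n. gs_residual d n x) \<longlonglongrightarrow> 0"
  proof (rule LIMSEQ_I)
    fix \<epsilon> :: real
    assume "\<epsilon> > 0"
    then obtain m where m: "norm (x - d m) < \<epsilon>"
      using dense by blast
    have "norm (gs_residual d n x - 0) < \<epsilon>" if "n \<ge> Suc m" for n
    proof -
      have "norm (gs_residual d n (d m)) \<le> 0"
        using norm_gs_residual_antimono[OF that, of d "d m"] unfolding gs_residual_Suc_self by simp
      then have "gs_residual d n x = gs_residual d n (x - d m)"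
        by (simp add: gs_residual_diff)
      then show ?thesis
        using norm_gs_residual_antimono[of 0 n d "x - d m"] m by simp
    qed
    then show "\<exists>no. \<forall>n\<ge>no. norm (gs_residual d n x - 0) < \<epsilon>"
      by blast
  qed
  then have "(\<lambda>n. (norm x)\<^sup>2 - (norm (gs_residual d n x))\<^sup>2) \<longlonglongrightarrow> (norm x)\<^sup>2 - (norm (0::'a))\<^sup>2"
    by (intro tendsto_intros)
  then show ?thesis
    by (simp add: sums_def bessel_gram_schmidt)
qed

section \<open>Perturbing a Parseval frame by small vectors\<close>

lemma frame_interleave_small:
  fixes e g :: "nat \<Rightarrow> 'a::real_inner"
  assumes parseval: "\<And>x. (\<lambda>k. (x \<bullet> e k)\<^sup>2) sums (norm x)\<^sup>2"
    and small: "\<And>n. (norm (g n))\<^sup>2 \<le> a n" "a sums \<delta>"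
  shows "frame_with_constants (\<lambda>n. if even n then e (n div 2) else g ((n - 1) div 2))
           (1 / sqrt (1 + \<delta>)) 1"
proof -
  have a_nonneg: "0 \<le> a n" for n
    using small(1)[of n] by (rule order_trans[OF zero_le_power2])
  have "\<delta> \<ge> 0"
    using suminf_nonneg[OF sums_summable[OF small(2)] a_nonneg] sums_unique[OF small(2)] by simp
  define h where "h = (\<lambda>n. if even n then e (n div 2) else g ((n - 1) div 2))"
  have frame_sum: "\<exists>s. (\<lambda>k. \<bar>f \<bullet> h k\<bar>\<^sup>2) sums s \<and> (norm f)\<^sup>2 \<le> s \<and> s \<le> (1 + \<delta>) * (norm f)\<^sup>2"
    for f
  proof -
    have le: "(f \<bullet> g n)\<^sup>2 \<le> (norm f)\<^sup>2 * a n" for n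
    proof -
      have "(f \<bullet> g n)\<^sup>2 \<le> (norm f)\<^sup>2 * (norm (g n))\<^sup>2"
        using Cauchy_Schwarz_ineq[of f "g n"] by (simp add: power2_norm_eq_inner)
      then show ?thesis
        using mult_left_mono[OF small(1)[of n] zero_le_power2[of "norm f"]] by linarith
    qed
    have bound: "(\<lambda>n. (norm f)\<^sup>2 * a n) sums ((norm f)\<^sup>2 * \<delta>)"
      by (rule sums_mult[OF small(2)])
    have summ: "summable (\<lambda>n. (f \<bullet> g n)\<^sup>2)"
      using le by (intro summable_comparison_test[OF _ sums_summable[OF bound]]) auto
    define t where "t = (\<Sum>n. (f \<bullet> g n)\<^sup>2)"
    have t: "(\<lambda>n. (f \<bullet> g n)\<^sup>2) sums t"
      unfolding t_def by (rule summable_sums[OF summ])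
    have "t \<ge> 0"
      unfolding t_def by (rule suminf_nonneg[OF summ]) simp
    moreover have "t \<le> (norm f)\<^sup>2 * \<delta>"
      using sums_le[OF le t bound] .
    moreover have "(\<lambda>k. \<bar>f \<bullet> h k\<bar>\<^sup>2) sums (t + (norm f)\<^sup>2)"
      using sums_if[OF t parseval[of f]] by (simp add: h_def if_distrib[of "\<lambda>v. (f \<bullet> v)\<^sup>2"])
    ultimately show ?thesis
      by (intro exI[of _ "t + (norm f)\<^sup>2"]) (simp add: algebra_simps)
  qed
  have "frame_with_constants h (1 / sqrt (1 + \<delta>)) 1"
    unfolding frame_with_constants_def
  proof (intro conjI allI)
    show "1 / sqrt (1 + \<delta>) > 0" "(1::real) > 0"
      using \<open>\<delta> \<ge> 0\<close> by simp_all
    fix f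
    obtain s where s: "(\<lambda>k. \<bar>f \<bullet> h k\<bar>\<^sup>2) sums s" "(norm f)\<^sup>2 \<le> s" "s \<le> (1 + \<delta>) * (norm f)\<^sup>2"
      using frame_sum by blast
    show "summable (\<lambda>k. \<bar>f \<bullet> h k\<bar>\<^sup>2)"
      by (rule sums_summable[OF s(1)])
    show "(1 / sqrt (1 + \<delta>))\<^sup>2 * (\<Sum>k. \<bar>f \<bullet> h k\<bar>\<^sup>2) \<le> (norm f)\<^sup>2"
      unfolding sums_unique[OF s(1), symmetric] using s(3) \<open>\<delta> \<ge> 0\<close>
      by (simp add: power_divide divide_le_eq mult.commute)
    show "(norm f)\<^sup>2 \<le> 1\<^sup>2 * (\<Sum>k. \<bar>f \<bullet> h k\<bar>\<^sup>2)"
      unfolding sums_unique[OF s(1), symmetric] using s(2) by simp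
  qed
  then show ?thesis
    by (simp add: h_def)
qed

lemma separable_imp_dense_sequence:
  assumes "separable_space (euclidean :: 'a::metric_space topology)"
  obtains d :: "nat \<Rightarrow> 'a::metric_space" where "\<And>x \<epsilon>. \<epsilon> > 0 \<Longrightarrow> \<exists>n. dist x (d n) < \<epsilon>"
proof -
  obtain D :: "'a set" where D: "countable D" "closure D = UNIV"
    using assms unfolding separable_space_def by auto
  then have "D \<noteq> {}"
    by auto
  show thesis
  proof
    fix x :: 'a and \<epsilon> :: real
    assume "\<epsilon> > 0"
    then obtain y where y: "y \<in> D" "dist y x < \<epsilon>"
      using D(2) closure_approachable[of x D] by auto
    then obtain n where "from_nat_into D n = y"
      using from_nat_into_surj[OF D(1)] by blast
    then show "\<exists>n. dist x (from_nat_into D n) < \<epsilon>"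
      using y(2) by (metis dist_commute)
  qed
qed

section \<open>Frames whose lines are dense\<close>

theorem mainTheorem3:
  fixes K :: "'a::{real_inner, complete_space} set" and C :: real
  assumes "separable_space (euclidean :: 'a topology)"
    and "compact K"
    and "C > 1"
  shows "\<exists>(h :: nat \<Rightarrow> 'a) (A :: real) (B :: real).
           frame_with_constants h A B \<and> B / A < C \<and>
           (\<forall>f\<in>K. \<forall>\<epsilon>>0. \<exists>(i :: nat) (c :: real). norm (f - c *\<^sub>R h i) < \<epsilon>)"
proof -
  obtain d :: "nat \<Rightarrow> 'a" where dense: "\<And>x \<epsilon>. \<epsilon> > 0 \<Longrightarrow> \<exists>n. norm (x - d n) < \<epsilon>"
    using separable_imp_dense_sequence[OF assms(1)] unfolding dist_norm by metis
  define \<delta> where "\<delta> = (C\<^sup>2 - 1) / 2"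
  have C2: "C\<^sup>2 > 1"
    using \<open>C > 1\<close> by (simp add: one_less_power)
  then have \<delta>: "\<delta> > 0" "1 + \<delta> < C\<^sup>2"
    by (simp_all add: \<delta>_def field_simps)
  define a :: "nat \<Rightarrow> real" where "a n = \<delta> * (1/2) ^ Suc n" for n
  have a: "a n > 0" for n
    using \<delta> by (simp add: a_def)
  have a_sums: "a sums \<delta>"
    using sums_mult[OF power_half_series, of \<delta>] by (simp add: a_def[abs_def])
  \<comment> \<open>The summand 1 keeps the factor nonzero even when \<open>d n = 0\<close>.\<close>
  define t where "t n = sqrt (a n) / (1 + norm (d n))" for n
  have t: "t n \<noteq> 0" for n
    using a[of n] norm_ge_zero[of "d n"] unfolding t_def by (simp add: add_nonneg_eq_0_iff)
  have small: "(norm (t n *\<^sub>R d n))\<^sup>2 \<le> a n" for n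
  proof -
    have pos: "0 < 1 + norm (d n)"
      by (simp add: add_pos_nonneg)
    have "norm (t n *\<^sub>R d n) = sqrt (a n) * (norm (d n) / (1 + norm (d n)))"
      using a[of n] pos by (simp add: t_def)
    also have "\<dots> \<le> sqrt (a n) * 1"
      using a[of n] pos by (intro mult_left_mono) (simp_all add: less_imp_le)
    finally have "(norm (t n *\<^sub>R d n))\<^sup>2 \<le> (sqrt (a n))\<^sup>2"
      by (intro power_mono) simp_all
    then show ?thesis
      using a[of n] by simp
  qed
  define h where
    "h = (\<lambda>n. if even n then gram_schmidt d (n div 2) else t ((n - 1) div 2) *\<^sub>R d ((n - 1) div 2))"
  have "frame_with_constants h (1 / sqrt (1 + \<delta>)) 1"
    unfolding h_def
    using frame_interleave_small[where g = "\<lambda>n. t n *\<^sub>R d n",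
        OF parseval_gram_schmidt[OF dense] small a_sums] by simp
  moreover have "1 / (1 / sqrt (1 + \<delta>)) < C"
    using real_sqrt_less_mono[OF \<delta>(2)] \<open>C > 1\<close> by simp
  moreover have "\<exists>i c. norm (f - c *\<^sub>R h i) < \<epsilon>" if "\<epsilon> > 0" for f \<epsilon>
  proof -
    obtain n where "norm (f - d n) < \<epsilon>"
      using dense[OF \<open>\<epsilon> > 0\<close>] by blast
    moreover have "(1 / t n) *\<^sub>R h (2 * n + 1) = d n"
      using t[of n] by (simp add: h_def)
    ultimately show ?thesis
      by metis
  qed
  ultimately show ?thesis
    by blast
qed

end
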